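(* Let $n,t$ be fixed integers with $1\le t\le n$, let $p=p(D)$ with $0\le p\le1$, and let $\mathfrak I\sim\mathcal I(n,D,p)$. Then $D^{-t}$ is a threshold function for the property $\dim(S/\mathfrak I)\le t-1$; that is, $$\lim_{D\to\infty}P\bigl(\dim(S/\mathfrak I)\le t-1\bigr)=\begin{cases}0,&\text{if }p=o(D^{-t}),\\ 1,&\text{if }p=\omega(D^{-t}).\end{cases}$$
   Context: Let $k$ be a field and $S=k[x_1,\dots,x_n]$. $\mathcal B(n,D,p)$ is the distribution of the random set $\mathfrak B$ of monomials of $S$ obtained by including each non-constant monomial of total degree at most $D$ independently with probability $p$. $\mathcal I(n,D,p)$ is the distribution of the random monomial ideal $\mathfrak I=(\mathfrak B)$, with $\mathfrak I=(0)$ if $\mathfrak B=\emptyset$. $\dim$ denotes Krull dimension. $f=o(g)$, equivalently $g=\omega(f)$, means $\lim_{D\to\infty} f/g=0$. *)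

theory Defs
  imports
    "HOL-Algebra.Algebra"
    "HOL-Library.Poly_Mapping"
    "HOL-Library.Landau_Symbols"
    "HOL-Library.Extended_Real"
    "HOL-Probability.Product_PMF"
begin

text \<open>Polynomials are finitely supported maps from exponent vectors to coefficients; the
  convolution product of \<^theory>\<open>HOL-Library.Poly_Mapping\<close> is polynomial multiplication.
  The variables of \<open>k[x\<^sub>1, \<dots>, x\<^sub>n]\<close> are indexed by \<open>0, \<dots>, n - 1\<close>.\<close>

type_synonym expvec = "nat \<Rightarrow>\<^sub>0 nat"
type_synonym 'k polys = "expvec \<Rightarrow>\<^sub>0 'k"

definition expvecs :: "nat \<Rightarrow> expvec set" where
  "expvecs n = {m. Poly_Mapping.keys m \<subseteq> {..<n}}"

definition mpoly_ring :: "nat \<Rightarrow> ('k::field) polys ring" where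
  "mpoly_ring n =
    \<lparr>carrier = {f. Poly_Mapping.keys f \<subseteq> expvecs n},
     monoid.mult = (*), one = 1, ring.zero = 0, add = (+)\<rparr>"

definition total_degree :: "expvec \<Rightarrow> nat" where
  "total_degree m = (\<Sum>i\<in>Poly_Mapping.keys m. Poly_Mapping.lookup m i)"

definition nonconst_monomials :: "nat \<Rightarrow> nat \<Rightarrow> ('k::field) polys set" where
  "nonconst_monomials n D =
    {Poly_Mapping.single m 1 | m. m \<in> expvecs n \<and> m \<noteq> 0 \<and> total_degree m \<le> D}"

text \<open>Finiteness matters because \<^const>\<open>Pi_pmf\<close> is only meaningful over a finite index set.\<close>

lemma finite_nonconst_monomials: "finite (nonconst_monomials n D :: ('k::field) polys set)"
proof -
  let ?F = "{f :: nat \<Rightarrow> nat. \<forall>i. (i \<in> {..<n} \<longrightarrow> f i \<in> {..D}) \<and> (i \<notin> {..<n} \<longrightarrow> f i = 0)}"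
  let ?M = "{m. m \<in> expvecs n \<and> m \<noteq> 0 \<and> total_degree m \<le> D}"
  have deg: "Poly_Mapping.lookup m i \<le> total_degree m" for m i
  proof (cases "i \<in> Poly_Mapping.keys m")
    case True
    then show ?thesis
      unfolding total_degree_def by (intro member_le_sum) auto
  qed (simp add: in_keys_iff)
  have "Poly_Mapping.lookup m \<in> ?F" if m: "m \<in> ?M" for m
  proof -
    have "Poly_Mapping.lookup m i \<le> D" for i
      using deg[of m i] m by simp
    moreover have "Poly_Mapping.lookup m i = 0" if "i \<notin> {..<n}" for i
    proof -
      have "i \<notin> Poly_Mapping.keys m"
        using m that unfolding expvecs_def by blast
      then show ?thesis by (simp add: in_keys_iff)
    qed
    ultimately show ?thesis by simp
  qed
  then have "Poly_Mapping.lookup ` ?M \<subseteq> ?F"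
    by (rule image_subsetI)
  moreover have "finite ?F"
    by (rule finite_set_of_finite_funs) auto
  ultimately have "finite (Poly_Mapping.lookup ` ?M)"
    by (rule finite_subset)
  moreover have "inj_on Poly_Mapping.lookup ?M"
    by (rule inj_onI) (simp add: poly_mapping_eqI)
  ultimately have "finite ?M"
    by (rule finite_imageD)
  then have "finite ((\<lambda>m. Poly_Mapping.single m (1::'k)) ` ?M)"
    by (rule finite_imageI)
  then show ?thesis
    unfolding nonconst_monomials_def by (simp only: setcompr_eq_image)
qed

text \<open>\<open>\<B>(n, D, p)\<close>\<close>

definition random_monomials :: "nat \<Rightarrow> nat \<Rightarrow> real \<Rightarrow> ('k::field) polys set pmf" where
  "random_monomials n D p =
    map_pmf (\<lambda>b. {x \<in> nonconst_monomials n D. b x})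
      (Pi_pmf (nonconst_monomials n D) False (\<lambda>_. bernoulli_pmf p))"

text \<open>\<open>\<I>(n, D, p)\<close>; the ideal generated by the empty set is the zero ideal.\<close>

definition random_monomial_ideal :: "nat \<Rightarrow> nat \<Rightarrow> real \<Rightarrow> ('k::field) polys set pmf" where
  "random_monomial_ideal n D p = map_pmf (\<lambda>B. Idl\<^bsub>mpoly_ring n\<^esub> B) (random_monomials n D p)"

text \<open>Krull dimension as the supremum of the lengths \<open>l\<close> of strict chains
  \<open>P\<^sub>0 \<subset> \<dots> \<subset> P\<^sub>l\<close> of prime ideals. It is \<open>-\<infinity>\<close> for the zero ring.\<close>

definition krull_dim :: "('a, 'b) ring_scheme \<Rightarrow> ereal" where
  "krull_dim R =
    (SUP l \<in> {l::nat. \<exists>P. (\<forall>i\<le>l. primeideal (P i) R) \<and> (\<forall>i<l. P i \<subset> P (Suc i))}.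
       ereal (real l))"

end

theory Submission
  imports Defs
begin

text \<open>The dimension of a quotient by a monomial ideal is combinatorial. If \<open>B\<close> is a set of
  non-constant monomials, then \<open>dim (S/(B)) \<le> t - 1\<close> exactly when every set \<open>T\<close> of \<open>t\<close> variables
  contains the support of a member of \<open>B\<close>. There are between \<open>\<lfloor>D/t\<rfloor>\<^sup>t\<close> and \<open>(D + 1)\<^sup>t\<close> candidates
  supported in a given \<open>T\<close>, so their expected number in \<open>B\<close> is of the order of \<open>p D\<^sup>t\<close>. If
  \<open>p D\<^sup>t\<close> tends to \<open>0\<close>, already one fixed \<open>T\<close> is likely to be missed (\<open>prob_dim_le\<close>). If \<open>p D\<^sup>t\<close>
  tends to infinity, a given \<open>T\<close> is missed with probability at most \<open>exp (- p \<lfloor>D/t\<rfloor>\<^sup>t)\<close>, and there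
  are only \<open>n choose t\<close> sets \<open>T\<close>, whatever \<open>D\<close> is (\<open>prob_dim_gt\<close>).

  One half of the dimension criterion is explicit (\<open>krull_dim_ge_if_no_generator\<close>): if \<open>T\<close> is missed,
  then \<open>(B)\<close> lies in the prime ideal generated by the variables outside \<open>T\<close>, and adjoining the
  variables in \<open>T\<close> one after another gives a chain of \<open>t + 1\<close> primes.

  For the other half (\<open>krull_dim_le_if_generators\<close>), let \<open>P\<^sub>0 \<subset> \<dots> \<subset> P\<^sub>l\<close> be primes above \<open>(B)\<close>.
  Since \<open>P\<^sub>0\<close> is prime and contains a monomial supported in each \<open>T\<close>, it contains a variable from
  each \<open>T\<close>, so at most \<open>t - 1\<close> variables are outside \<open>P\<^sub>0\<close>. It remains to see that \<open>l\<close> is at most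
  the number \<open>m\<close> of these variables. Pick \<open>a\<^sub>i\<close> in \<open>P\<^sub>i\<^sub>+\<^sub>1\<close> but not in \<open>P\<^sub>i\<close>, without loss of
  generality a polynomial in the \<open>m\<close> variables only. If \<open>l > m\<close>, then \<open>a\<^sub>0, \<dots>, a\<^sub>l\<^sub>-\<^sub>1\<close> are
  algebraically dependent, because there are \<open>N\<^sup>l\<close> power products with exponents below \<open>N\<close>, and they
  lie in a space of dimension \<open>O(N\<^sup>m)\<close>. But no nontrivial polynomial relation between the \<open>a\<^sub>i\<close>
  can hold modulo \<open>P\<^sub>0\<close> (\<open>no_relation_along_prime_chain\<close>): cancel the lowest power of \<open>a\<^sub>0\<close>, which
  is not in the prime \<open>P\<^sub>0\<close>; modulo \<open>P\<^sub>1\<close>, which contains \<open>a\<^sub>0\<close>, what is left is a nontrivial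
  relation between \<open>a\<^sub>1, \<dots>, a\<^sub>l\<^sub>-\<^sub>1\<close>. In the end a nonzero constant would lie in \<open>P\<^sub>l\<close>.\<close>


section \<open>Prime ideals of a quotient ring\<close>

lemma carrier_quot: "carrier (R Quot I) = (\<lambda>r. I +>\<^bsub>R\<^esub> r) ` carrier R"
  unfolding FactRing_def A_RCOSETS_def' by auto

lemma (in cring) primeideal_quot_image:
  assumes I: "ideal I R" and J: "primeideal J R" and sub: "I \<subseteq> J"
  shows "primeideal ((+>) I ` J) (R Quot I)"
proof -
  interpret I: ideal I R by (rule I)
  interpret J: primeideal J R by (rule J)
  have cQ: "cring (R Quot I)"
    by (rule I.quotient_is_cring) (rule is_cring)
  have hom: "(+>) I \<in> ring_hom R (R Quot I)"
    by (rule I.rcos_ring_hom)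
  note carr = carrier_quot[of R I]
  have mem: "x \<in> J" if x: "x \<in> carrier R" and *: "I +> x \<in> (+>) I ` J" for x
  proof -
    from * obtain j where j: "j \<in> J" "I +> x = I +> j" by blast
    have "x \<in> I +> j"
      using I.a_rcos_self[OF x] j(2) by simp
    then obtain i where "i \<in> I" "x = i \<oplus> j"
      unfolding a_r_coset_def' by blast
    then show ?thesis using sub j(1) by auto
  qed
  show ?thesis
  proof (rule primeidealI)
    show "ideal ((+>) I ` J) (R Quot I)"
      by (rule ring_ideal_imp_quot_ideal[OF I J.is_ideal])
    show "cring (R Quot I)" by (rule cQ)
    show "carrier (R Quot I) \<noteq> (+>) I ` J"
    proof
      assume eq: "carrier (R Quot I) = (+>) I ` J"
      have "x \<in> J" if "x \<in> carrier R" for x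
        using that eq carr by (intro mem) auto
      then have "carrier R \<subseteq> J" ..
      with J.a_subset J.I_notcarr show False by blast
    qed
    fix a b
    assume a: "a \<in> carrier (R Quot I)" and b: "b \<in> carrier (R Quot I)"
      and ab: "a \<otimes>\<^bsub>R Quot I\<^esub> b \<in> (+>) I ` J"
    obtain x where x: "x \<in> carrier R" "a = I +> x"
      using a unfolding carr by (rule imageE)
    obtain y where y: "y \<in> carrier R" "b = I +> y"
      using b unfolding carr by (rule imageE)
    note xy = x(1) y(1) x(2) y(2)
    have "I +> (x \<otimes> y) \<in> (+>) I ` J"
      using ab unfolding xy ring_hom_mult[OF hom xy(1,2)] .
    then have "x \<otimes> y \<in> J" by (rule mem[OF m_closed[OF xy(1,2)]])
    then have "x \<in> J \<or> y \<in> J" by (rule J.I_prime[OF xy(1,2)])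
    then show "a \<in> (+>) I ` J \<or> b \<in> (+>) I ` J" unfolding xy by (elim disjE) (auto intro: imageI)
  qed
qed

lemma (in cring) primeideal_quot_vimage:
  assumes I: "ideal I R" and P: "primeideal P (R Quot I)"
  shows "primeideal {r \<in> carrier R. I +> r \<in> P} R" and "I \<subseteq> {r \<in> carrier R. I +> r \<in> P}"
proof -
  interpret I: ideal I R by (rule I)
  interpret P: primeideal P "R Quot I" by (rule P)
  interpret h: ring_hom_ring R "R Quot I" "(+>) I" by (rule I.rcos_ring_hom_ring)
  note carr = carrier_quot[of R I]
  show "primeideal {r \<in> carrier R. I +> r \<in> P} R"
  proof (rule primeidealI)
    show "ideal {r \<in> carrier R. I +> r \<in> P} R"
      by (rule h.ideal_vimage) (rule P.is_ideal)
    show "cring R" by (rule is_cring)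
    show "carrier R \<noteq> {r \<in> carrier R. I +> r \<in> P}"
    proof
      assume "carrier R = {r \<in> carrier R. I +> r \<in> P}"
      then have "carrier (R Quot I) \<subseteq> P" unfolding carr by blast
      with P.a_subset P.I_notcarr show False by blast
    qed
    fix a b
    assume "a \<in> carrier R" "b \<in> carrier R" "a \<otimes> b \<in> {r \<in> carrier R. I +> r \<in> P}"
    then show "a \<in> {r \<in> carrier R. I +> r \<in> P} \<or> b \<in> {r \<in> carrier R. I +> r \<in> P}"
      using P.I_prime[of "I +> a" "I +> b"] by auto
  qed
  show "I \<subseteq> {r \<in> carrier R. I +> r \<in> P}"
  proof
    fix r assume r: "r \<in> I"
    then have "I +> r = I" by (rule I.a_rcos_const)
    moreover have "\<zero>\<^bsub>R Quot I\<^esub> = I" by (simp only: FactRing_def ring_record_simps)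
    moreover have "\<zero>\<^bsub>R Quot I\<^esub> \<in> P"
      by (rule additive_subgroup.zero_closed[OF P.additive_subgroup_axioms])
    moreover have "r \<in> carrier R" using r I.a_subset by blast
    ultimately show "r \<in> {r \<in> carrier R. I +> r \<in> P}" by simp
  qed
qed

definition prime_chain :: "('a, 'b) ring_scheme \<Rightarrow> nat \<Rightarrow> (nat \<Rightarrow> 'a set) \<Rightarrow> bool" where
  "prime_chain R l P \<longleftrightarrow> (\<forall>i\<le>l. primeideal (P i) R) \<and> (\<forall>i<l. P i \<subset> P (Suc i))"

text \<open>Prime ideals of a quotient are compared with those above \<open>I\<close> by taking images and preimages, so
  that everything below can be done with ideals of the polynomial ring.\<close>

lemma (in cring) prime_chain_quot_iff:
  assumes I: "ideal I R"
  shows "(\<exists>P. prime_chain (R Quot I) l P) \<longleftrightarrow> (\<exists>Q. prime_chain R l Q \<and> I \<subseteq> Q 0)"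
proof
  interpret I: ideal I R by (rule I)
  note carr = carrier_quot[of R I]
  assume "\<exists>P. prime_chain (R Quot I) l P"
  then obtain P where P: "\<And>i. i \<le> l \<Longrightarrow> primeideal (P i) (R Quot I)"
    "\<And>i. i < l \<Longrightarrow> P i \<subset> P (Suc i)"
    unfolding prime_chain_def by blast
  define Q where "Q i = {r \<in> carrier R. I +> r \<in> P i}" for i
  have "prime_chain R l Q"
    unfolding prime_chain_def
  proof (intro conjI allI impI)
    fix i assume "i \<le> l"
    then show "primeideal (Q i) R"
      unfolding Q_def by (intro primeideal_quot_vimage(1)[OF I] P)
  next
    fix i assume i: "i < l"
    obtain x where x: "x \<in> P (Suc i)" "x \<notin> P i" using P(2)[OF i] by blast
    interpret S: primeideal "P (Suc i)" "R Quot I" using P(1) i by simp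
    have "x \<in> (+>) I ` carrier R" using x S.a_subset carr by blast
    then show "Q i \<subset> Q (Suc i)" using x P(2)[OF i] unfolding Q_def by blast
  qed
  moreover have "I \<subseteq> Q 0"
    unfolding Q_def by (rule primeideal_quot_vimage(2)[OF I P(1)]) simp
  ultimately show "\<exists>Q. prime_chain R l Q \<and> I \<subseteq> Q 0" by blast
next
  interpret I: ideal I R by (rule I)
  assume "\<exists>Q. prime_chain R l Q \<and> I \<subseteq> Q 0"
  then obtain Q where Q: "\<And>i. i \<le> l \<Longrightarrow> primeideal (Q i) R"
    "\<And>i. i < l \<Longrightarrow> Q i \<subset> Q (Suc i)" "I \<subseteq> Q 0"
    unfolding prime_chain_def by blast
  have IQ: "I \<subseteq> Q i" if "i \<le> l" for i
    using that
  proof (induction i)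
    case (Suc i)
    then have "I \<subseteq> Q i" "Q i \<subset> Q (Suc i)" using Q(2)[of i] by auto
    then show ?case by blast
  qed (rule Q(3))
  have ideal: "ideal (Q i) R" if "i \<le> l" for i
    using Q(1)[OF that] by (rule primeideal.axioms(1))
  have "prime_chain (R Quot I) l (\<lambda>i. (+>) I ` Q i)"
    unfolding prime_chain_def
  proof (intro conjI allI impI)
    fix i assume "i \<le> l"
    then show "primeideal ((+>) I ` Q i) (R Quot I)"
      by (intro primeideal_quot_image I Q IQ)
  next
    fix i assume i: "i < l"
    have "inj_on (\<lambda>J. (+>) I ` J) {J. ideal J R \<and> I \<subseteq> J}"
      using quot_ideal_correspondence[OF I] by (rule bij_betw_imp_inj_on)
    moreover have "Q i \<in> {J. ideal J R \<and> I \<subseteq> J}" "Q (Suc i) \<in> {J. ideal J R \<and> I \<subseteq> J}"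
      using ideal IQ i by simp_all
    ultimately have "(+>) I ` Q i = (+>) I ` Q (Suc i) \<Longrightarrow> Q i = Q (Suc i)"
      by (blast dest: inj_onD)
    then have "(+>) I ` Q i \<noteq> (+>) I ` Q (Suc i)"
      using Q(2)[OF i] by blast
    then show "(+>) I ` Q i \<subset> (+>) I ` Q (Suc i)"
      using Q(2)[OF i] by blast
  qed
  then show "\<exists>P. prime_chain (R Quot I) l P" by blast
qed

section \<open>The polynomial ring and its variable ideals\<close>

definition polys_in :: "nat set \<Rightarrow> ('k::field) polys set" where
  "polys_in T = {f. \<forall>m\<in>Poly_Mapping.keys f. Poly_Mapping.keys m \<subseteq> T}"

lemma keys_add_nat: "Poly_Mapping.keys (a + b :: expvec) = Poly_Mapping.keys a \<union> Poly_Mapping.keys b"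
  by (auto simp: in_keys_iff lookup_add)

lemma polys_in_add: "f \<in> polys_in T \<Longrightarrow> g \<in> polys_in T \<Longrightarrow> f + g \<in> polys_in T"
  unfolding polys_in_def using keys_add[of f g] by blast

lemma polys_in_mult: "f \<in> polys_in T \<Longrightarrow> g \<in> polys_in T \<Longrightarrow> f * g \<in> polys_in T"
  unfolding polys_in_def using keys_mult[of f g] by (fastforce simp: keys_add_nat)

lemma polys_in_uminus: "f \<in> polys_in T \<Longrightarrow> - f \<in> polys_in T"
  unfolding polys_in_def by (simp add: in_keys_iff)

lemma polys_in_0: "0 \<in> polys_in T" and polys_in_1: "1 \<in> polys_in T"
  and polys_in_const: "Poly_Mapping.single 0 c \<in> polys_in T"
  unfolding polys_in_def by (auto simp del: single_one)

lemma polys_in_single: "Poly_Mapping.keys m \<subseteq> T \<Longrightarrow> Poly_Mapping.single m c \<in> polys_in T"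
  unfolding polys_in_def by auto

lemma polys_in_power: "f \<in> polys_in T \<Longrightarrow> f ^ k \<in> polys_in T"
  by (induction k) (auto intro: polys_in_mult polys_in_1)

lemma polys_in_sum: "(\<And>x. x \<in> A \<Longrightarrow> f x \<in> polys_in T) \<Longrightarrow> sum f A \<in> polys_in T"
  by (induction A rule: infinite_finite_induct) (auto intro: polys_in_add polys_in_0)

lemma polys_in_mono: "S \<subseteq> T \<Longrightarrow> polys_in S \<subseteq> polys_in T"
  unfolding polys_in_def by auto

lemma mpoly_ring_simps [simp]:
  "carrier (mpoly_ring n) = polys_in {..<n}"
  "monoid.mult (mpoly_ring n) = (*)" "one (mpoly_ring n) = 1"
  "ring.zero (mpoly_ring n) = 0" "add (mpoly_ring n) = (+)"
  by (auto simp: mpoly_ring_def polys_in_def expvecs_def)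

lemma cring_mpoly_ring: "cring (mpoly_ring n :: ('k::field) polys ring)"
proof (rule cringI)
  show "abelian_group (mpoly_ring n :: 'k polys ring)"
  proof (rule abelian_groupI)
    fix x :: "'k polys" assume "x \<in> carrier (mpoly_ring n)"
    then show "\<exists>y\<in>carrier (mpoly_ring n). y \<oplus>\<^bsub>mpoly_ring n\<^esub> x = \<zero>\<^bsub>mpoly_ring n\<^esub>"
      by (intro bexI[of _ "- x"]) (simp_all add: polys_in_uminus)
  qed (simp_all add: polys_in_add polys_in_0 algebra_simps)
  show "comm_monoid (mpoly_ring n :: 'k polys ring)"
    by (rule comm_monoidI) (simp_all add: polys_in_mult polys_in_1 algebra_simps)
qed (simp_all add: algebra_simps)

lemma mpoly_idealI:
  fixes I :: "('k::field) polys set"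
  assumes "I \<subseteq> polys_in {..<n}" "0 \<in> I" "\<And>f g. f \<in> I \<Longrightarrow> g \<in> I \<Longrightarrow> f + g \<in> I"
    and mult: "\<And>f g. f \<in> polys_in {..<n} \<Longrightarrow> g \<in> I \<Longrightarrow> f * g \<in> I"
  shows "ideal I (mpoly_ring n)"
proof -
  interpret cring "mpoly_ring n :: 'k polys ring" by (rule cring_mpoly_ring)
  show ?thesis
  proof (rule idealI)
    show "ring (mpoly_ring n :: 'k polys ring)" by (rule ring_axioms)
    show "subgroup I (add_monoid (mpoly_ring n))"
    proof (rule add.subgroupI)
      fix a assume a: "a \<in> I"
      have "\<ominus>\<^bsub>mpoly_ring n\<^esub> a = - a"
        using a assms(1) by (intro minus_equality) (auto simp: polys_in_uminus)
      moreover have "- 1 * a \<in> I"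
        by (intro mult a polys_in_uminus polys_in_1)
      ultimately show "\<ominus>\<^bsub>mpoly_ring n\<^esub> a \<in> I"
        by simp
    qed (use assms in auto)
    fix a x :: "'k polys"
    assume "a \<in> I" "x \<in> carrier (mpoly_ring n)"
    then have "x * a \<in> I" by (simp add: mult)
    then show "x \<otimes>\<^bsub>mpoly_ring n\<^esub> a \<in> I" "a \<otimes>\<^bsub>mpoly_ring n\<^esub> x \<in> I"
      by (simp_all add: mult.commute)
  qed
qed

lemma mpoly_idealD:
  fixes I :: "('k::field) polys set"
  assumes "ideal I (mpoly_ring n)"
  shows "I \<subseteq> polys_in {..<n}" "0 \<in> I" "\<And>f g. f \<in> I \<Longrightarrow> g \<in> I \<Longrightarrow> f + g \<in> I"
    "\<And>f g. f \<in> polys_in {..<n} \<Longrightarrow> g \<in> I \<Longrightarrow> f * g \<in> I"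
    "\<And>f. f \<in> I \<Longrightarrow> - f \<in> I"
    "\<And>F A. (\<And>x. x \<in> A \<Longrightarrow> F x \<in> I) \<Longrightarrow> sum F A \<in> I"
proof -
  interpret ideal I "mpoly_ring n" by fact
  show sub: "I \<subseteq> polys_in {..<n}" using a_subset by simp
  show z: "0 \<in> I" using additive_subgroup.zero_closed[OF additive_subgroup_axioms] by simp
  show add: "f + g \<in> I" if "f \<in> I" "g \<in> I" for f g
    using additive_subgroup.a_closed[OF additive_subgroup_axioms that] by simp
  show mult: "f * g \<in> I" if "f \<in> polys_in {..<n}" "g \<in> I" for f g
    using I_l_closed that by simp
  show "- f \<in> I" if "f \<in> I" for f
    using mult[of "- 1" f] that by (simp add: polys_in_uminus polys_in_1)
  show "sum F A \<in> I" if "\<And>x. x \<in> A \<Longrightarrow> F x \<in> I" for F and A :: "'x set"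
    using that by (induction A rule: infinite_finite_induct) (auto intro: z add)
qed

lemma mpoly_primeD:
  assumes "primeideal P (mpoly_ring n)"
  shows "ideal P (mpoly_ring n)" "1 \<notin> P"
    "\<And>f g. f \<in> polys_in {..<n} \<Longrightarrow> g \<in> polys_in {..<n} \<Longrightarrow> f * g \<in> P \<Longrightarrow> f \<in> P \<or> g \<in> P"
proof -
  interpret primeideal P "mpoly_ring n" by fact
  show "ideal P (mpoly_ring n)" by (rule is_ideal)
  show "1 \<notin> P" using one_imp_carrier I_notcarr by auto
  show "f \<in> P \<or> g \<in> P" if "f \<in> polys_in {..<n}" "g \<in> polys_in {..<n}" "f * g \<in> P" for f g
    using I_prime[of f g] that by simp
qed

text \<open>The retraction that sets the variables in \<open>A\<close> to zero. It is a ring homomorphism whose kernel is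
  the ideal generated by these variables.\<close>

definition drop_vars :: "nat set \<Rightarrow> ('k::field) polys \<Rightarrow> 'k polys" where
  "drop_vars A f = (\<Sum>m\<in>{m\<in>Poly_Mapping.keys f. Poly_Mapping.keys m \<inter> A = {}}.
     Poly_Mapping.single m (Poly_Mapping.lookup f m))"

lemma lookup_drop_vars:
  "Poly_Mapping.lookup (drop_vars A f) m =
     (if Poly_Mapping.keys m \<inter> A = {} then Poly_Mapping.lookup f m else 0)"
  unfolding drop_vars_def
  by (auto simp: lookup_sum lookup_single when_def in_keys_iff sum.delta')

lemma drop_vars_in:
  assumes "f \<in> polys_in T"
  shows "drop_vars A f \<in> polys_in (T - A)"
  using assms unfolding polys_in_def
  by (auto simp: in_keys_iff[of _ f] in_keys_iff[of _ "drop_vars A f"] lookup_drop_vars split: if_splits)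

lemma poly_sum_monomials:
  "f = (\<Sum>m\<in>Poly_Mapping.keys f. Poly_Mapping.single m (Poly_Mapping.lookup f m))"
  by (rule poly_mapping_eqI) (auto simp: lookup_sum lookup_single when_def in_keys_iff sum.delta')

text \<open>The ideal generated by the variables in \<open>A\<close>, described by its monomials. This description makes
  membership and primality easy to check; \<open>var_ideal_least\<close> relates it to the generators.\<close>

definition var_ideal :: "nat \<Rightarrow> nat set \<Rightarrow> ('k::field) polys set" where
  "var_ideal n A = {f \<in> polys_in {..<n}. \<forall>m\<in>Poly_Mapping.keys f. Poly_Mapping.keys m \<inter> A \<noteq> {}}"

lemma drop_vars_eq_0_iff:
  "f \<in> polys_in {..<n} \<Longrightarrow> f \<in> var_ideal n A \<longleftrightarrow> drop_vars A f = 0"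
  unfolding var_ideal_def poly_mapping_eq_iff fun_eq_iff
  by (auto simp: lookup_drop_vars in_keys_iff)

lemma diff_drop_vars:
  assumes "f \<in> polys_in {..<n}"
  shows "f - drop_vars A f \<in> var_ideal n A"
  using assms unfolding var_ideal_def polys_in_def
  by (auto simp: in_keys_iff lookup_minus lookup_drop_vars split: if_splits)

lemma var_ideal_ideal: "ideal (var_ideal n A :: ('k::field) polys set) (mpoly_ring n)"
proof (rule mpoly_idealI)
  show "f + g \<in> var_ideal n A" if "f \<in> var_ideal n A" "g \<in> var_ideal n A" for f g :: "'k polys"
    using that keys_add[of f g] unfolding var_ideal_def by (auto intro: polys_in_add)
  show "f * g \<in> var_ideal n A" if "f \<in> polys_in {..<n}" "g \<in> var_ideal n A" for f g :: "'k polys"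
    using that keys_mult[of f g] unfolding var_ideal_def
    by (fastforce intro: polys_in_mult simp: keys_add_nat)
qed (auto simp: var_ideal_def polys_in_0)

text \<open>Modulo the ideal, a polynomial may be replaced by its part without variables from \<open>A\<close>. Products
  of such parts again avoid \<open>A\<close>, so they lie in the ideal only if they vanish, and the polynomial
  ring has no zero divisors.\<close>

lemma var_ideal_prime: "primeideal (var_ideal n A :: ('k::field) polys set) (mpoly_ring n)"
proof (rule primeidealI)
  show "ideal (var_ideal n A :: 'k polys set) (mpoly_ring n)" by (rule var_ideal_ideal)
  note D = mpoly_idealD[OF this]
  show "cring (mpoly_ring n :: 'k polys ring)" by (rule cring_mpoly_ring)
  have "(1 :: 'k polys) \<notin> var_ideal n A" unfolding var_ideal_def by simp
  then show "carrier (mpoly_ring n) \<noteq> (var_ideal n A :: 'k polys set)"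
    using polys_in_1 by auto
  fix f g :: "'k polys"
  assume "f \<in> carrier (mpoly_ring n)" "g \<in> carrier (mpoly_ring n)"
    and "f \<otimes>\<^bsub>mpoly_ring n\<^esub> g \<in> var_ideal n A"
  then have f: "f \<in> polys_in {..<n}" and g: "g \<in> polys_in {..<n}" and fg: "f * g \<in> var_ideal n A"
    by auto
  let ?f = "drop_vars A f" and ?g = "drop_vars A g"
  have f': "?f \<in> polys_in {..<n}" and g': "?g \<in> polys_in {..<n}"
    using drop_vars_in[OF f, of A] drop_vars_in[OF g, of A] polys_in_mono[of "{..<n} - A" "{..<n}"] by auto
  have "?f * ?g = f * g + - (f * (g - ?g)) + - (?g * (f - ?f))"
    by (simp add: algebra_simps)
  also have "\<dots> \<in> var_ideal n A"
    by (intro D(3) D(5) fg D(4) f g' diff_drop_vars g)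
  finally have 1: "?f * ?g \<in> var_ideal n A" .
  have "?f * ?g \<in> polys_in ({..<n} - A)"
    by (intro polys_in_mult drop_vars_in f g)
  with 1 have "Poly_Mapping.keys (?f * ?g) = {}"
    unfolding var_ideal_def polys_in_def by blast
  then have "?f * ?g = 0" by simp
  then have "?f = 0 \<or> ?g = 0" by simp
  then show "f \<in> var_ideal n A \<or> g \<in> var_ideal n A"
    using f g drop_vars_eq_0_iff by blast
qed

lemma single_split_var:
  fixes c :: "'k::field" and m :: expvec
  assumes "j \<in> Poly_Mapping.keys m"
  shows "Poly_Mapping.single m c =
    Poly_Mapping.single (m - Poly_Mapping.single j 1) c * Poly_Mapping.single (Poly_Mapping.single j 1) 1"
proof -
  have "m - Poly_Mapping.single j 1 + Poly_Mapping.single j 1 = m"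
    using assms
    by (intro poly_mapping_eqI) (auto simp: lookup_add lookup_minus lookup_single when_def in_keys_iff Suc_leI)
  then show ?thesis by (simp add: mult_single)
qed

lemma keys_minus_subset: "Poly_Mapping.keys (m - m' :: expvec) \<subseteq> Poly_Mapping.keys m"
  by (auto simp: in_keys_iff lookup_minus)

lemma var_ideal_least:
  fixes I :: "('k::field) polys set"
  assumes I: "ideal I (mpoly_ring n)"
    and vars: "\<And>j. j \<in> A \<Longrightarrow> Poly_Mapping.single (Poly_Mapping.single j 1) 1 \<in> I"
  shows "var_ideal n A \<subseteq> I"
proof
  note D = mpoly_idealD[OF I]
  fix f :: "'k polys" assume f: "f \<in> var_ideal n A"
  have "(\<Sum>m\<in>Poly_Mapping.keys f. Poly_Mapping.single m (Poly_Mapping.lookup f m)) \<in> I"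
  proof (rule D(6))
    fix m assume m: "m \<in> Poly_Mapping.keys f"
    with f obtain j where j: "j \<in> Poly_Mapping.keys m" "j \<in> A" and sub: "Poly_Mapping.keys m \<subseteq> {..<n}"
      unfolding var_ideal_def polys_in_def by blast
    show "Poly_Mapping.single m (Poly_Mapping.lookup f m) \<in> I"
      using sub keys_minus_subset[of m]
      by (subst single_split_var[OF j(1)]) (intro D(4) vars j polys_in_single, blast)
  qed
  then show "f \<in> I" by (simp flip: poly_sum_monomials)
qed

text \<open>A monomial is a product of variables; its degree decreases as they are split off.\<close>

lemma prime_contains_var:
  assumes P: "primeideal P (mpoly_ring n)"
    and "Poly_Mapping.single m 1 \<in> P" "Poly_Mapping.keys m \<subseteq> {..<n}"
  shows "\<exists>j\<in>Poly_Mapping.keys m. Poly_Mapping.single (Poly_Mapping.single j 1) 1 \<in> P"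
  using assms(2,3)
proof (induction "\<Sum>j<n. Poly_Mapping.lookup m j" arbitrary: m rule: less_induct)
  case less
  note P = mpoly_primeD[OF P]
  have "m \<noteq> 0" using less.prems P(2) by auto
  then obtain j where j: "j \<in> Poly_Mapping.keys m" by (metis keys_eq_empty ex_in_conv)
  let ?m = "m - Poly_Mapping.single j 1"
  have jn: "j < n" using j less.prems by auto
  have sub: "Poly_Mapping.keys ?m \<subseteq> Poly_Mapping.keys m" by (rule keys_minus_subset)
  have sm: "(\<Sum>i<n. Poly_Mapping.lookup ?m i) < (\<Sum>i<n. Poly_Mapping.lookup m i)"
    using j jn by (intro sum_strict_mono_ex1) (auto simp: lookup_minus lookup_single when_def in_keys_iff intro!: bexI[of _ j])
  have "Poly_Mapping.single ?m 1 \<in> P \<or> Poly_Mapping.single (Poly_Mapping.single j 1) 1 \<in> P"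
    using less.prems(1)[unfolded single_split_var[OF j, of 1]] sub less.prems(2) jn
    by (intro P(3) polys_in_single) auto
  then show ?case
    using less.hyps[OF sm] sub less.prems(2) j by blast
qed


section \<open>Lower bound for the dimension\<close>

lemma krull_dim_quot_ge:
  assumes I: "ideal I (mpoly_ring n :: ('k::field) polys ring)"
    and Q: "prime_chain (mpoly_ring n) l Q" "I \<subseteq> Q 0"
  shows "ereal (real l) \<le> krull_dim (mpoly_ring n Quot I)"
proof -
  interpret cring "mpoly_ring n :: 'k polys ring" by (rule cring_mpoly_ring)
  have "\<exists>P. prime_chain (mpoly_ring n Quot I) l P"
    using prime_chain_quot_iff[OF I] Q by blast
  then show ?thesis
    unfolding krull_dim_def prime_chain_def by (intro SUP_upper) simp
qed

lemma krull_dim_quot_le: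
  assumes I: "ideal I (mpoly_ring n :: ('k::field) polys ring)"
    and Q: "\<And>l Q. prime_chain (mpoly_ring n) l Q \<Longrightarrow> I \<subseteq> Q 0 \<Longrightarrow> l \<le> d"
  shows "krull_dim (mpoly_ring n Quot I) \<le> ereal (real d)"
proof -
  interpret cring "mpoly_ring n :: 'k polys ring" by (rule cring_mpoly_ring)
  have "l \<le> d" if "\<exists>P. prime_chain (mpoly_ring n Quot I) l P" for l
    using that prime_chain_quot_iff[OF I] Q by blast
  then show ?thesis
    unfolding krull_dim_def prime_chain_def by (intro SUP_least) simp
qed

lemma var_ideal_chain:
  assumes "t \<le> n"
  shows "prime_chain (mpoly_ring n) t (\<lambda>i. var_ideal n {..<n - t + i} :: ('k::field) polys set)"
  unfolding prime_chain_def
proof (intro conjI allI impI var_ideal_prime)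
  fix i assume i: "i < t"
  let ?x = "Poly_Mapping.single (Poly_Mapping.single (n - t + i) 1) 1 :: 'k polys"
  have "?x \<in> var_ideal n {..<n - t + Suc i}" "?x \<notin> var_ideal n {..<n - t + i}"
    using i assms unfolding var_ideal_def polys_in_def by auto
  moreover have "(var_ideal n {..<n - t + i} :: 'k polys set) \<subseteq> var_ideal n {..<n - t + Suc i}"
    unfolding var_ideal_def by fastforce
  ultimately show "(var_ideal n {..<n - t + i} :: 'k polys set) \<subset> var_ideal n {..<n - t + Suc i}"
    by blast
qed

text \<open>The generators all involve one of the first \<open>n - t\<close> variables, so the chain that starts with the
  ideal of these variables lies above the ideal they generate.\<close>

lemma krull_dim_ge_if_no_generator:
  fixes B :: "('k::field) polys set"
  assumes "t \<le> n" "B \<subseteq> nonconst_monomials n D"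
    and none: "\<And>m. Poly_Mapping.single m 1 \<in> B \<Longrightarrow> \<not> Poly_Mapping.keys m \<subseteq> {n - t..<n}"
  shows "ereal (real t) \<le> krull_dim (mpoly_ring n Quot (Idl\<^bsub>mpoly_ring n\<^esub> B))"
proof -
  interpret cring "mpoly_ring n :: 'k polys ring" by (rule cring_mpoly_ring)
  have B: "B \<subseteq> carrier (mpoly_ring n)"
    using assms(2) unfolding nonconst_monomials_def expvecs_def by (auto intro!: polys_in_single)
  have "B \<subseteq> var_ideal n {..<n - t}"
  proof
    fix f assume f: "f \<in> B"
    with assms(2) obtain m where m: "f = Poly_Mapping.single m 1" "Poly_Mapping.keys m \<subseteq> {..<n}"
      unfolding nonconst_monomials_def expvecs_def by blast
    with f none[of m] have "Poly_Mapping.keys m \<inter> {..<n - t} \<noteq> {}"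
      by fastforce
    then show "f \<in> var_ideal n {..<n - t}"
      using m polys_in_single[of m] unfolding var_ideal_def by auto
  qed
  then have "Idl\<^bsub>mpoly_ring n\<^esub> B \<subseteq> var_ideal n {..<n - t + 0}"
    using genideal_minimal[OF var_ideal_ideal] by simp
  then show ?thesis
    by (rule krull_dim_quot_ge[OF genideal_ideal[OF B] var_ideal_chain[OF assms(1)]])
qed

section \<open>Polynomials with bounded exponents\<close>

text \<open>Bounding each exponent separately, instead of the total degree, gives sets with a closed formula
  for the cardinality. For the growth rates in question the two bounds are equivalent.\<close>

definition exponent_box :: "nat set \<Rightarrow> nat \<Rightarrow> expvec set" where
  "exponent_box T d = {m. Poly_Mapping.keys m \<subseteq> T \<and> (\<forall>i. Poly_Mapping.lookup m i \<le> d)}"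

lemma exponent_box_bij:
  assumes "finite T"
  shows "bij_betw (\<lambda>m. restrict (Poly_Mapping.lookup m) T) (exponent_box T d) (PiE T (\<lambda>_. {..d}))"
proof (rule bij_betwI')
  fix x y assume "x \<in> exponent_box T d" "y \<in> exponent_box T d"
  then have *: "Poly_Mapping.keys x \<subseteq> T" "Poly_Mapping.keys y \<subseteq> T"
    by (auto simp: exponent_box_def)
  have "x = y" if "restrict (Poly_Mapping.lookup x) T = restrict (Poly_Mapping.lookup y) T"
  proof (rule poly_mapping_eqI)
    fix k show "Poly_Mapping.lookup x k = Poly_Mapping.lookup y k"
      using that * by (cases "k \<in> T") (metis restrict_apply, metis in_keys_iff subsetD)
  qed
  then show "restrict (Poly_Mapping.lookup x) T = restrict (Poly_Mapping.lookup y) T \<longleftrightarrow> x = y"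
    by blast
next
  fix x assume "x \<in> exponent_box T d"
  then show "restrict (Poly_Mapping.lookup x) T \<in> T \<rightarrow>\<^sub>E {..d}"
    by (auto simp: exponent_box_def)
next
  fix g assume g: "g \<in> T \<rightarrow>\<^sub>E {..d}"
  define x where "x = Abs_poly_mapping (\<lambda>i. if i \<in> T then g i else 0)"
  have x: "Poly_Mapping.lookup x = (\<lambda>i. if i \<in> T then g i else 0)"
    unfolding x_def by (rule lookup_Abs_poly_mapping) (rule finite_subset[OF _ assms], auto)
  have "x \<in> exponent_box T d"
    using g unfolding exponent_box_def by (auto simp: x in_keys_iff split: if_splits)
  moreover have "g = restrict (Poly_Mapping.lookup x) T"
    using g by (auto simp: x fun_eq_iff PiE_def extensional_def)
  ultimately show "\<exists>x\<in>exponent_box T d. g = restrict (Poly_Mapping.lookup x) T"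
    by blast
qed

lemma finite_exponent_box: "finite T \<Longrightarrow> finite (exponent_box T d)"
  using bij_betw_finite[OF exponent_box_bij] by (simp add: finite_PiE)

lemma card_exponent_box: "finite T \<Longrightarrow> card (exponent_box T d) = (d + 1) ^ card T"
  using bij_betw_same_card[OF exponent_box_bij] by (simp add: card_PiE)

definition box_polys :: "nat set \<Rightarrow> nat \<Rightarrow> ('k::field) polys set" where
  "box_polys T d = {f. Poly_Mapping.keys f \<subseteq> exponent_box T d}"

lemma box_polys_mult:
  assumes "f \<in> box_polys T d" "g \<in> box_polys T e"
  shows "f * g \<in> box_polys T (d + e)"
proof -
  have "a + b \<in> exponent_box T (d + e)" if "a \<in> exponent_box T d" "b \<in> exponent_box T e" for a b
    using that unfolding exponent_box_def by (auto simp: keys_add_nat lookup_add intro: add_mono)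
  then show ?thesis
    using assms keys_mult[of f g] unfolding box_polys_def by blast
qed

lemma box_polys_one: "1 \<in> box_polys T d"
  unfolding box_polys_def exponent_box_def by simp

lemma box_polys_power: "f \<in> box_polys T d \<Longrightarrow> f ^ k \<in> box_polys T (k * d)"
  by (induction k) (auto intro: box_polys_mult box_polys_one)

lemma box_polys_mono: "d \<le> e \<Longrightarrow> box_polys T d \<subseteq> box_polys T e"
  unfolding box_polys_def exponent_box_def by (auto intro: order_trans)

lemma polys_in_imp_box_polys:
  assumes "f \<in> polys_in T"
  shows "\<exists>d. f \<in> box_polys T d"
proof
  let ?d = "\<Sum>m\<in>Poly_Mapping.keys f. \<Sum>i\<in>Poly_Mapping.keys m. Poly_Mapping.lookup m i"
  have "Poly_Mapping.lookup m i \<le> ?d" if m: "m \<in> Poly_Mapping.keys f" for m i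
  proof (cases "i \<in> Poly_Mapping.keys m")
    case True
    then have "Poly_Mapping.lookup m i \<le> (\<Sum>i\<in>Poly_Mapping.keys m. Poly_Mapping.lookup m i)"
      by (intro member_le_sum) auto
    also have "\<dots> \<le> ?d"
      using m by (intro member_le_sum) auto
    finally show ?thesis .
  qed (simp add: in_keys_iff)
  then show "f \<in> box_polys T ?d"
    using assms unfolding box_polys_def exponent_box_def polys_in_def by auto
qed

section \<open>Algebraic dependence and chains of primes\<close>

definition power_product :: "'a::comm_monoid_mult list \<Rightarrow> nat list \<Rightarrow> 'a" where
  "power_product as es = prod_list (map2 (^) as es)"

lemma power_product_simps [simp]:
  "power_product [] es = 1" "power_product (a # as) (e # es) = a ^ e * power_product as es"
  by (simp_all add: power_product_def)

lemma power_product_box: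
  assumes "length es = length as" "\<And>a. a \<in> set as \<Longrightarrow> a \<in> box_polys T d" "\<And>e. e \<in> set es \<Longrightarrow> e \<le> N"
  shows "power_product as es \<in> box_polys T (length as * (N * d))"
  using assms
proof (induction es as rule: list_induct2)
  case (Cons e es a as)
  have "a ^ e \<in> box_polys T (e * d)"
    using Cons.prems by (intro box_polys_power) auto
  moreover have "box_polys T (e * d) \<subseteq> (box_polys T (N * d) :: 'a polys set)"
    using Cons.prems by (intro box_polys_mono mult_right_mono) auto
  ultimately have "a ^ e * power_product as es \<in> box_polys T (N * d + length as * (N * d))"
    using Cons by (intro box_polys_mult) auto
  then show ?case by simp
qed (auto intro: box_polys_one)

lemma power_product_in:
  assumes "length es = length as" "\<And>a. a \<in> set as \<Longrightarrow> a \<in> polys_in T"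
  shows "power_product as es \<in> polys_in T"
  using assms
  by (induction es as rule: list_induct2) (auto intro: polys_in_1 polys_in_mult polys_in_power)

lemma poly_vector_space:
  "vector_space (\<lambda>c (f :: ('k::field) polys). Poly_Mapping.single 0 c * f)"
proof
  fix a b :: 'k and f :: "'k polys"
  show "Poly_Mapping.single 0 a * (Poly_Mapping.single 0 b * f) = Poly_Mapping.single 0 (a * b) * f"
    by (simp add: mult_single flip: mult.assoc)
qed (simp_all add: algebra_simps single_add)

text \<open>More polynomials than there are monomials to span them are linearly dependent. Formulating this
  for a family rather than a set covers coinciding power products, which give a relation at once.\<close>

lemma linear_relation:
  fixes v :: "'i \<Rightarrow> ('k::field) polys"
  assumes T: "finite T" and E: "finite E" and card: "(d + 1) ^ card T < card E"
    and v: "\<And>e. e \<in> E \<Longrightarrow> v e \<in> box_polys T d"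
  shows "\<exists>c. (\<exists>e\<in>E. c e \<noteq> 0) \<and> (\<Sum>e\<in>E. Poly_Mapping.single 0 (c e) * v e) = 0"
proof (cases "inj_on v E")
  case False
  then obtain x y where xy: "x \<in> E" "y \<in> E" "x \<noteq> y" "v x = v y"
    unfolding inj_on_def by blast
  \<comment> \<open>Two equal members of the family cancel.\<close>
  define c :: "'i \<Rightarrow> 'k" where "c = (\<lambda>_. 0)(x := 1, y := - 1)"
  have "(\<Sum>e\<in>E. Poly_Mapping.single 0 (c e) * v e) = (\<Sum>e\<in>{x, y}. Poly_Mapping.single 0 (c e) * v e)"
    using E xy by (intro sum.mono_neutral_right) (auto simp: c_def)
  also have "\<dots> = 0"
    using xy by (simp add: c_def single_uminus)
  finally show ?thesis
    using xy by (intro exI[of _ c]) (auto simp: c_def)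
next
  case True
  interpret vector_space "\<lambda>c (f :: 'k polys). Poly_Mapping.single 0 c * f"
    by (rule poly_vector_space)
  define M where "M = (\<lambda>m. Poly_Mapping.single m (1::'k)) ` exponent_box T d"
  have M: "finite M" "card M \<le> (d + 1) ^ card T"
    unfolding M_def card_exponent_box[OF T, symmetric]
    using finite_exponent_box[OF T] by (auto intro: card_image_le)
  have "v ` E \<subseteq> span M"
  proof
    fix f assume "f \<in> v ` E"
    then have f: "Poly_Mapping.keys f \<subseteq> exponent_box T d"
      using v by (auto simp: box_polys_def)
    have "f = (\<Sum>m\<in>Poly_Mapping.keys f. Poly_Mapping.single 0 (Poly_Mapping.lookup f m) * Poly_Mapping.single m 1)"
      by (subst poly_sum_monomials) (simp add: mult_single)
    also have "\<dots> \<in> span M"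
      using f by (intro span_sum span_scale span_base) (auto simp: M_def)
    finally show "f \<in> span M" .
  qed
  moreover have "\<not> card (v ` E) \<le> card M"
    using card M card_image[OF True] by linarith
  ultimately have "dependent (v ` E)"
    using independent_span_bound[OF M(1)] by blast
  then obtain u where u: "(\<Sum>f\<in>v ` E. Poly_Mapping.single 0 (u f) * f) = 0" "\<exists>f\<in>v ` E. u f \<noteq> 0"
    using dependent_finite[of "v ` E"] E by auto
  then show ?thesis
    using True by (intro exI[of _ "u \<circ> v"]) (auto simp: sum.reindex)
qed

lemma prime_power_notin:
  assumes P: "primeideal P (mpoly_ring n)" and a: "a \<in> polys_in {..<n}" "a \<notin> P"
  shows "a ^ r \<notin> P"
proof (induction r)
  case (Suc r)
  then show ?case
    using mpoly_primeD(3)[OF P a(1) polys_in_power[OF a(1), of r]] a(2) by auto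
qed (use mpoly_primeD(2)[OF P] in simp)

text \<open>Induction along the chain. Among the exponent vectors in \<open>E\<close>, those with the least first entry
  \<open>r\<close> are collected in \<open>S0\<close> and the others in \<open>S1\<close>, so that the sum is \<open>a\<^sup>r (a S1 + S0)\<close>. As \<open>a\<close>
  avoids the prime \<open>P 0\<close>, the second factor lies in \<open>P 0\<close>, hence in \<open>P 1\<close>. As \<open>a\<close> lies in \<open>P 1\<close>, so
  does \<open>S0\<close>, which is a sum of the same kind over a nonempty set of shorter exponent vectors.\<close>

lemma no_relation_along_prime_chain:
  fixes as :: "('k::field) polys list"
  assumes "\<And>i. i \<le> length as \<Longrightarrow> primeideal (P i) (mpoly_ring n)"
    and "\<And>i. i < length as \<Longrightarrow> P i \<subseteq> P (Suc i)"
    and "\<And>i. i < length as \<Longrightarrow> as ! i \<in> P (Suc i) - P i"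
    and "finite E" "E \<noteq> {}" "\<And>e. e \<in> E \<Longrightarrow> length e = length as" "\<And>e. e \<in> E \<Longrightarrow> c e \<noteq> 0"
  shows "(\<Sum>e\<in>E. Poly_Mapping.single 0 (c e) * power_product as e) \<notin> P 0"
  using assms
proof (induction as arbitrary: P E c)
  case Nil
  then have "E = {[]}" by auto
  moreover have "Poly_Mapping.single 0 (c []) \<notin> P 0"
  proof
    assume *: "Poly_Mapping.single 0 (c []) \<in> P 0"
    note P = mpoly_primeD[OF Nil.prems(1)[of 0, simplified]]
    have "Poly_Mapping.single 0 (inverse (c [])) * Poly_Mapping.single 0 (c []) \<in> P 0"
      by (intro mpoly_idealD(4)[OF P(1)] polys_in_const *)
    moreover have "c [] \<noteq> 0" using Nil.prems(7) \<open>E = {[]}\<close> by simp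
    ultimately show False using P(2) by (simp add: mult_single)
  qed
  ultimately show ?case by simp
next
  case (Cons a as)
  note prime = Cons.prems(1) and inc = Cons.prems(2) and step = Cons.prems(3)
  have "primeideal (P 0) (mpoly_ring n)" "primeideal (P 1) (mpoly_ring n)"
    using prime[of 0] prime[of 1] by auto
  note P0 = mpoly_primeD[OF this(1)] and P1 = mpoly_primeD[OF this(2)]
  have aP: "a \<in> P 1" "a \<notin> P 0" using step[of 0] by auto
  have a: "a \<in> polys_in {..<n}" using aP(1) mpoly_idealD(1)[OF P1(1)] by auto
  have as: "x \<in> polys_in {..<n}" if "x \<in> set as" for x
  proof -
    from that obtain i where i: "i < length as" "x = as ! i" by (metis in_set_conv_nth)
    then have "x \<in> P (Suc (Suc i))" using step[of "Suc i"] by auto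
    moreover have "ideal (P (Suc (Suc i))) (mpoly_ring n)"
      using prime[of "Suc (Suc i)"] i by (intro mpoly_primeD(1)) auto
    ultimately show ?thesis using mpoly_idealD(1) by blast
  qed
  have ne: "e = hd e # tl e" "length (tl e) = length as" if "e \<in> E" for e
    using Cons.prems(6)[OF that] by (cases e; simp)+
  define r where "r = Min (hd ` E)"
  have r: "r \<le> hd e" if "e \<in> E" for e
    unfolding r_def using Cons.prems(4) that by (intro Min_le) auto
  have "r \<in> hd ` E"
    unfolding r_def using Cons.prems(4,5) by (intro Min_in) auto
  define E0 where "E0 = {e\<in>E. hd e = r}"
  define S0 where "S0 = (\<Sum>e\<in>E0. Poly_Mapping.single 0 (c e) * power_product as (tl e))"
  define S1 where "S1 = (\<Sum>e\<in>E - E0. Poly_Mapping.single 0 (c e) *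
      (a ^ (hd e - r - 1) * power_product as (tl e)))"
  have fin: "finite E0" and sub: "E0 \<subseteq> E" and ne0: "E0 \<noteq> {}"
    using Cons.prems(4) \<open>r \<in> hd ` E\<close> by (auto simp: E0_def)
  have S: "S0 \<in> polys_in {..<n}" "S1 \<in> polys_in {..<n}"
    unfolding S0_def S1_def using sub ne(2) as a
    by (auto intro!: polys_in_sum polys_in_mult polys_in_const polys_in_power power_product_in)
  show ?case
  proof
    assume in0: "(\<Sum>e\<in>E. Poly_Mapping.single 0 (c e) * power_product (a # as) e) \<in> P 0"
    have "(\<Sum>e\<in>E. Poly_Mapping.single 0 (c e) * power_product (a # as) e) =
        (\<Sum>e\<in>E. Poly_Mapping.single 0 (c e) * (a ^ hd e * power_product as (tl e)))"
      by (intro sum.cong refl) (metis ne(1) power_product_simps(2))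
    also have "\<dots> = (\<Sum>e\<in>E - E0. Poly_Mapping.single 0 (c e) * (a ^ hd e * power_product as (tl e)))
        + (\<Sum>e\<in>E0. Poly_Mapping.single 0 (c e) * (a ^ hd e * power_product as (tl e)))"
      by (rule sum.subset_diff[OF sub Cons.prems(4)])
    also have "(\<Sum>e\<in>E0. Poly_Mapping.single 0 (c e) * (a ^ hd e * power_product as (tl e))) = a ^ r * S0"
      unfolding S0_def sum_distrib_left by (intro sum.cong) (auto simp: E0_def mult_ac)
    also have "(\<Sum>e\<in>E - E0. Poly_Mapping.single 0 (c e) * (a ^ hd e * power_product as (tl e)))
        = a ^ r * (a * S1)"
      unfolding S1_def sum_distrib_left
    proof (intro sum.cong refl)
      fix e assume e: "e \<in> E - E0"
      then have "hd e = r + (1 + (hd e - r - 1))" using r[of e] by (auto simp: E0_def)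
      then have "a ^ hd e = a ^ r * (a * a ^ (hd e - r - 1))"
        by (metis power_add power_one_right)
      then show "Poly_Mapping.single 0 (c e) * (a ^ hd e * power_product as (tl e)) =
          a ^ r * (a * (Poly_Mapping.single 0 (c e) * (a ^ (hd e - r - 1) * power_product as (tl e))))"
        by (simp add: mult_ac)
    qed
    finally have "a ^ r * (a * S1 + S0) \<in> P 0"
      using in0 by (simp add: distrib_left)
    moreover have "a ^ r \<notin> P 0"
      using prime_power_notin[OF prime[of 0] a aP(2)] by simp
    ultimately have "a * S1 + S0 \<in> P 0"
      using P0(3)[of "a ^ r" "a * S1 + S0"] a S by (auto intro: polys_in_power polys_in_add polys_in_mult)
    then have 1: "a * S1 + S0 \<in> P 1" using inc[of 0] by auto
    have 2: "S1 * a \<in> P 1" by (intro mpoly_idealD(4)[OF P1(1)] S aP)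
    have "a * S1 + S0 + - (S1 * a) \<in> P 1"
      by (rule mpoly_idealD(3)[OF P1(1) 1 mpoly_idealD(5)[OF P1(1) 2]])
    then have "S0 \<in> P 1" by (simp add: mult.commute)
    also have "S0 = (\<Sum>e\<in>tl ` E0. Poly_Mapping.single 0 (c (r # e)) * power_product as e)"
    proof -
      have "inj_on tl E0"
        using ne sub by (intro inj_onI) (metis (mono_tags, lifting) E0_def mem_Collect_eq)
      moreover have "r # tl e = e" if "e \<in> E0" for e
        using that ne(1)[of e] by (auto simp: E0_def)
      ultimately show ?thesis
        by (simp add: sum.reindex S0_def)
    qed
    finally have *: "(\<Sum>e\<in>tl ` E0. Poly_Mapping.single 0 (c (r # e)) * power_product as e) \<in> P (Suc 0)"
      by simp
    have "(\<Sum>e\<in>tl ` E0. Poly_Mapping.single 0 (c (r # e)) * power_product as e) \<notin> P (Suc 0)"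
    proof (rule Cons.IH[of "\<lambda>i. P (Suc i)"])
      fix i assume "i < length as"
      then show "P (Suc i) \<subseteq> P (Suc (Suc i))" "as ! i \<in> P (Suc (Suc i)) - P (Suc i)"
        using inc[of "Suc i"] step[of "Suc i"] by auto
    next
      fix i assume "i \<le> length as"
      then show "primeideal (P (Suc i)) (mpoly_ring n)" using prime[of "Suc i"] by simp
    next
      fix e' assume "e' \<in> tl ` E0"
      then obtain e where e: "e \<in> E" "hd e = r" "e' = tl e" by (auto simp: E0_def)
      then have "r # e' = e" using ne(1)[of e] by simp
      then show "length e' = length as" "c (r # e') \<noteq> 0"
        using e ne(2) Cons.prems(7) by auto
    qed (use fin ne0 in auto)
    with * show False by contradiction
  qed
qed

text \<open>The numbers compared are the dimension of the space of polynomials in \<open>m\<close> variables with exponents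
  at most \<open>l N d\<close>, and the number of power products of \<open>l\<close> factors with exponents below \<open>N\<close>.\<close>

lemma power_growth:
  fixes l d m :: nat
  assumes "m < l"
  shows "\<exists>N. (l * (N * d) + 1) ^ m < N ^ l"
proof -
  define N where "N = (l * d + 1) ^ m + 1"
  have "l * (N * d) + 1 \<le> N * (l * d + 1)"
    by (simp add: N_def algebra_simps)
  then have "(l * (N * d) + 1) ^ m \<le> N ^ m * (l * d + 1) ^ m"
    by (metis power_mono power_mult_distrib zero_le)
  also have "\<dots> < N ^ m * N" by (simp add: N_def)
  also have "\<dots> = N ^ Suc m" by simp
  also have "\<dots> \<le> N ^ l" using assms by (intro power_increasing) (auto simp: N_def)
  finally show ?thesis ..
qed

text \<open>For empty \<open>A\<close> this is the upper bound \<open>n\<close> for the Krull dimension of a polynomial ring in \<open>n\<close>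
  variables. In general the elements that witness the strict inclusions can be chosen free of the
  variables in \<open>A\<close>, because these variables lie in every ideal of the chain.\<close>

lemma prime_chain_length_le:
  fixes Q :: "nat \<Rightarrow> ('k::field) polys set"
  assumes chain: "prime_chain (mpoly_ring n) l Q" and sub: "var_ideal n A \<subseteq> Q 0"
  shows "l \<le> card ({..<n} - A)"
proof (rule ccontr)
  define T where "T = {..<n} - A"
  have T: "finite T" "T \<subseteq> {..<n}" by (auto simp: T_def)
  assume "\<not> l \<le> card ({..<n} - A)"
  then have less: "card T < l" by (simp add: T_def)
  have prime: "primeideal (Q i) (mpoly_ring n)" if "i \<le> l" for i
    using chain that by (simp add: prime_chain_def)
  have inc: "Q i \<subset> Q (Suc i)" if "i < l" for i
    using chain that by (simp add: prime_chain_def)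
  have subi: "var_ideal n A \<subseteq> Q i" if "i \<le> l" for i
    using that
  proof (induction i)
    case (Suc i)
    then show ?case using inc[of i] by auto
  qed (rule sub)
  have "\<exists>a. a \<in> Q (Suc i) - Q i \<and> a \<in> polys_in T" if i: "i < l" for i
  proof -
    obtain a where a: "a \<in> Q (Suc i)" "a \<notin> Q i" using inc[OF i] by blast
    note I = mpoly_idealD[OF mpoly_primeD(1)[OF prime[of "Suc i"]]]
    note I' = mpoly_idealD[OF mpoly_primeD(1)[OF prime[of i]]]
    have an: "a \<in> polys_in {..<n}" using I(1) a i by auto
    \<comment> \<open>The removed part \<open>?r\<close> lies in all ideals of the chain, so \<open>drop_vars A a\<close> separates \<open>Q i\<close> from
      \<open>Q (Suc i)\<close> just as \<open>a\<close> does.\<close>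
    let ?r = "a - drop_vars A a"
    have r: "?r \<in> Q i" "?r \<in> Q (Suc i)"
      using diff_drop_vars[OF an, of A] subi[of i] subi[of "Suc i"] i by auto
    have "a + - ?r \<in> Q (Suc i)" using i by (intro I(3) I(5) a r) auto
    moreover have "drop_vars A a \<notin> Q i"
    proof
      assume "drop_vars A a \<in> Q i"
      then have "drop_vars A a + ?r \<in> Q i" using i by (intro I'(3) r) auto
      with a show False by simp
    qed
    ultimately show ?thesis
      using drop_vars_in[OF an, of A] by (intro exI[of _ "drop_vars A a"]) (auto simp: T_def)
  qed
  then obtain b where b: "\<And>i. i < l \<Longrightarrow> b i \<in> Q (Suc i) - Q i" "\<And>i. i < l \<Longrightarrow> b i \<in> polys_in T"
    by metis
  have "\<forall>i. \<exists>d. i < l \<longrightarrow> b i \<in> box_polys T d"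
    using b(2) polys_in_imp_box_polys by blast
  then obtain ds where ds: "\<And>i. i < l \<Longrightarrow> b i \<in> box_polys T (ds i)" by metis
  define d where "d = (\<Sum>i<l. ds i)"
  have d: "b i \<in> box_polys T d" if "i < l" for i
  proof -
    have "ds i \<le> d" unfolding d_def using that by (intro member_le_sum) auto
    then show ?thesis using ds[OF that] box_polys_mono by blast
  qed
  define as where "as = map b [0..<l]"
  \<comment> \<open>With this \<open>N\<close> the power products with exponents below \<open>N\<close> outnumber the monomials in their box.\<close>
  obtain N where N: "(l * (N * d) + 1) ^ card T < N ^ l" using power_growth[OF less] by blast
  define E where "E = {es. set es \<subseteq> {..<N} \<and> length es = l}"
  have E: "finite E" "card E = N ^ l"
    unfolding E_def by (simp_all add: finite_lists_length_eq card_lists_length_eq)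
  have as: "a \<in> box_polys T d" if "a \<in> set as" for a
    using that d by (auto simp: as_def)
  have "power_product as e \<in> box_polys T (l * (N * d))" if "e \<in> E" for e
  proof -
    have "length e = length as" "\<And>k. k \<in> set e \<Longrightarrow> k \<le> N"
      using that by (auto simp: E_def as_def less_imp_le)
    then show ?thesis
      using power_product_box[of e as T d N] as by (simp add: as_def)
  qed
  then obtain c where c: "\<exists>e\<in>E. c e \<noteq> 0"
      "(\<Sum>e\<in>E. Poly_Mapping.single 0 (c e) * power_product as e) = 0"
    using linear_relation[OF T(1) E(1), of "l * (N * d)" "power_product as"] N E(2) by auto
  define F where "F = {e\<in>E. c e \<noteq> 0}"
  have finF: "finite F" using E(1) by (simp add: F_def)
  have "(\<Sum>e\<in>F. Poly_Mapping.single 0 (c e) * power_product as e) =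
      (\<Sum>e\<in>E. Poly_Mapping.single 0 (c e) * power_product as e)"
    using E(1) by (intro sum.mono_neutral_left) (auto simp: F_def)
  also have "\<dots> \<in> Q 0"
    using c(2) mpoly_idealD(2)[OF mpoly_primeD(1)[OF prime[of 0]]] by simp
  finally have "(\<Sum>e\<in>F. Poly_Mapping.single 0 (c e) * power_product as e) \<in> Q 0" .
  moreover have "(\<Sum>e\<in>F. Poly_Mapping.single 0 (c e) * power_product as e) \<notin> Q 0"
  proof (rule no_relation_along_prime_chain[where n = n, OF _ _ _ finF])
    show "F \<noteq> {}" "\<And>e. e \<in> F \<Longrightarrow> length e = length as" "\<And>e. e \<in> F \<Longrightarrow> c e \<noteq> 0"
      using c(1) by (auto simp: F_def E_def as_def)
  qed (use prime inc b(1) in \<open>auto simp: as_def\<close>)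
  ultimately show False by contradiction
qed

text \<open>Let \<open>A\<close> be the set of variables in the smallest prime of a chain. By primality \<open>A\<close> meets the
  support of every monomial in that prime, hence every set of \<open>t\<close> variables; so fewer than \<open>t\<close>
  variables are outside \<open>A\<close>, and their number bounds the length of the chain.\<close>

lemma krull_dim_le_if_generators:
  fixes B :: "('k::field) polys set"
  assumes "1 \<le> t" "B \<subseteq> nonconst_monomials n D"
    and gens: "\<And>T. T \<subseteq> {..<n} \<Longrightarrow> card T = t \<Longrightarrow>
      \<exists>m. Poly_Mapping.single m 1 \<in> B \<and> Poly_Mapping.keys m \<subseteq> T"
  shows "krull_dim (mpoly_ring n Quot (Idl\<^bsub>mpoly_ring n\<^esub> B)) \<le> ereal (real t - 1)"
proof -
  interpret cring "mpoly_ring n :: 'k polys ring" by (rule cring_mpoly_ring)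
  have B: "B \<subseteq> carrier (mpoly_ring n)"
    using assms(2) unfolding nonconst_monomials_def expvecs_def by (auto intro!: polys_in_single)
  have "krull_dim (mpoly_ring n Quot (Idl\<^bsub>mpoly_ring n\<^esub> B)) \<le> ereal (real (t - 1))"
  proof (rule krull_dim_quot_le[OF genideal_ideal[OF B]])
    fix l and Q :: "nat \<Rightarrow> 'k polys set"
    assume Q: "prime_chain (mpoly_ring n) l Q" "Idl\<^bsub>mpoly_ring n\<^esub> B \<subseteq> Q 0"
    have prime: "primeideal (Q 0) (mpoly_ring n)" using Q(1) by (simp add: prime_chain_def)
    have BQ: "B \<subseteq> Q 0" using genideal_self[OF B] Q(2) by blast
    define A where "A = {j. Poly_Mapping.single (Poly_Mapping.single j 1) 1 \<in> Q 0}"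
    have "var_ideal n A \<subseteq> Q 0"
      by (rule var_ideal_least[OF mpoly_primeD(1)[OF prime]]) (simp add: A_def)
    then have "l \<le> card ({..<n} - A)"
      by (rule prime_chain_length_le[OF Q(1)])
    also have "card ({..<n} - A) < t"
    proof (rule ccontr)
      assume "\<not> card ({..<n} - A) < t"
      then obtain T where T: "T \<subseteq> {..<n} - A" "card T = t"
        by (meson not_less obtain_subset_with_card_n)
      then obtain m where m: "Poly_Mapping.single m 1 \<in> B" "Poly_Mapping.keys m \<subseteq> T"
        using gens[of T] by blast
      then obtain j where "j \<in> Poly_Mapping.keys m" "j \<in> A"
        using prime_contains_var[OF prime, of m] BQ T by (auto simp: A_def)
      with m T show False by blast
    qed
    finally show "l \<le> t - 1" by simp
  qed
  then show ?thesis using assms(1) by (simp add: of_nat_diff)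
qed


section \<open>Counting and probabilities\<close>

definition monomials_in :: "nat \<Rightarrow> nat \<Rightarrow> nat set \<Rightarrow> ('k::field) polys set" where
  "monomials_in n D T = {x \<in> nonconst_monomials n D. \<exists>m. x = Poly_Mapping.single m 1 \<and> Poly_Mapping.keys m \<subseteq> T}"

lemma lookup_le_total_degree: "Poly_Mapping.lookup m i \<le> total_degree m"
proof (cases "i \<in> Poly_Mapping.keys m")
  case True
  then show ?thesis unfolding total_degree_def by (intro member_le_sum) auto
qed (simp add: in_keys_iff)

lemma inj_monomial: "inj (\<lambda>m :: expvec. Poly_Mapping.single m (1::'k::field))"
proof (rule injI)
  fix m m' :: expvec
  assume "Poly_Mapping.single m (1::'k) = Poly_Mapping.single m' 1"
  then have "Poly_Mapping.keys (Poly_Mapping.single m (1::'k)) = Poly_Mapping.keys (Poly_Mapping.single m' (1::'k))"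
    by (rule arg_cong)
  then show "m = m'" by simp
qed

lemma card_monomials_in:
  assumes "T \<subseteq> {..<n}"
  shows "card (monomials_in n D T :: ('k::field) polys set) =
     card {m. Poly_Mapping.keys m \<subseteq> T \<and> m \<noteq> 0 \<and> total_degree m \<le> D}"
    (is "_ = card ?M")
proof -
  have "(monomials_in n D T :: 'k polys set) = (\<lambda>m. Poly_Mapping.single m 1) ` ?M"
    using assms unfolding monomials_in_def nonconst_monomials_def expvecs_def
    by (auto dest: injD[OF inj_monomial])
  then show ?thesis
    by (simp add: card_image inj_on_subset[OF inj_monomial])
qed

lemma card_monomials_in_le:
  assumes "T \<subseteq> {..<n}"
  shows "card (monomials_in n D T :: ('k::field) polys set) \<le> (D + 1) ^ card T"
proof -
  have T: "finite T" using assms finite_subset by blast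
  have "{m. Poly_Mapping.keys m \<subseteq> T \<and> m \<noteq> 0 \<and> total_degree m \<le> D} \<subseteq> exponent_box T D"
    unfolding exponent_box_def using lookup_le_total_degree le_trans by blast
  then show ?thesis
    unfolding card_monomials_in[OF assms] card_exponent_box[OF T, symmetric]
    by (intro card_mono finite_exponent_box T)
qed

text \<open>A monomial in \<open>card T\<close> variables with exponents at most \<open>q\<close> has degree at most \<open>D\<close>. The box of
  these exponents has more than \<open>q ^ card T\<close> elements, so this many remain without the constant.\<close>

lemma card_monomials_in_ge:
  assumes sub: "T \<subseteq> {..<n}" and q: "card T * q \<le> D" and ne: "T \<noteq> {}"
  shows "q ^ card T \<le> card (monomials_in n D T :: ('k::field) polys set)"
proof -
  have T: "finite T" using sub finite_subset by blast
  let ?M = "{m. Poly_Mapping.keys m \<subseteq> T \<and> m \<noteq> 0 \<and> total_degree m \<le> D}"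
  have "finite ?M"
    by (rule finite_subset[OF _ finite_exponent_box[OF T, of D]])
      (auto simp: exponent_box_def intro: order_trans[OF lookup_le_total_degree])
  moreover have "exponent_box T q - {0} \<subseteq> ?M"
  proof
    fix m assume "m \<in> exponent_box T q - {0}"
    then have m: "Poly_Mapping.keys m \<subseteq> T" "\<And>i. Poly_Mapping.lookup m i \<le> q" "m \<noteq> 0"
      by (auto simp: exponent_box_def)
    have "total_degree m \<le> card (Poly_Mapping.keys m) * q"
      unfolding total_degree_def using sum_bounded_above[of "Poly_Mapping.keys m" "Poly_Mapping.lookup m" q] m(2)
      by simp
    also have "\<dots> \<le> card T * q"
      using card_mono[OF T m(1)] by simp
    finally show "m \<in> ?M" using m q by simp
  qed
  ultimately have "card (exponent_box T q - {0}) \<le> card ?M"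
    by (rule card_mono)
  moreover have "0 \<in> exponent_box T q"
    by (simp add: exponent_box_def)
  ultimately have "(q + 1) ^ card T - 1 \<le> card ?M"
    by (simp add: card_exponent_box[OF T])
  moreover have "q ^ card T < (q + 1) ^ card T"
    using T ne by (intro power_strict_mono) (auto simp: card_gt_0_iff)
  ultimately show ?thesis
    unfolding card_monomials_in[OF sub] by linarith
qed

lemma set_random_monomials: "set_pmf (random_monomials n D p) \<subseteq> Pow (nonconst_monomials n D)"
  unfolding random_monomials_def by auto

lemma prob_random_monomials_disjoint:
  fixes M :: "('k::field) polys set"
  assumes M: "M \<subseteq> nonconst_monomials n D" and p: "0 \<le> p" "p \<le> 1"
  shows "measure_pmf.prob (random_monomials n D p) {B. B \<inter> M = {}} = (1 - p) ^ card M"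
proof -
  let ?N = "nonconst_monomials n D :: 'k polys set"
  let ?X = "Pi_pmf ?N False (\<lambda>_. bernoulli_pmf p)"
  have fin: "finite ?N" by (rule finite_nonconst_monomials)
  have "(\<lambda>b. {x \<in> ?N. b x}) -` {B. B \<inter> M = {}} = Pi ?N (\<lambda>x. if x \<in> M then {False} else UNIV)"
    using M by (auto simp: Pi_def split: if_splits)
  then have "measure_pmf.prob (random_monomials n D p) {B. B \<inter> M = {}} =
      measure_pmf.prob ?X (Pi ?N (\<lambda>x. if x \<in> M then {False} else UNIV))"
    unfolding random_monomials_def measure_map_pmf by simp
  also have "\<dots> = (\<Prod>x\<in>?N. measure_pmf.prob (bernoulli_pmf p) (if x \<in> M then {False} else UNIV))"
    by (rule measure_Pi_pmf_Pi[OF fin])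
  also have "\<dots> = (\<Prod>x\<in>?N. if x \<in> M then 1 - p else 1)"
    using p by (intro prod.cong) (auto simp: measure_pmf_single)
  also have "\<dots> = (\<Prod>x\<in>M. 1 - p)"
    using prod.inter_restrict[OF fin, of "\<lambda>_. 1 - p" M] M by (simp add: Int_absorb1)
  finally show ?thesis by simp
qed

text \<open>The bound on the dimension forces a generator supported in the last \<open>t\<close> variables. The union
  bound over the possible generators takes the form of Bernoulli's inequality here, because the
  probability that none of them occurs is known exactly.\<close>

lemma prob_dim_le:
  assumes "1 \<le> t" "t \<le> n" and p: "0 \<le> p" "p \<le> 1"
  shows "measure_pmf.prob (random_monomial_ideal n D p :: ('k::field) polys set pmf)
      {\<II>. krull_dim (mpoly_ring n Quot \<II>) \<le> ereal (real t - 1)} \<le> (real D + 1) ^ t * p"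
proof -
  let ?T = "{n - t..<n}"
  let ?M = "monomials_in n D ?T :: 'k polys set"
  let ?G = "{\<II> :: 'k polys set. krull_dim (mpoly_ring n Quot \<II>) \<le> ereal (real t - 1)}"
  let ?R = "random_monomials n D p :: 'k polys set pmf"
  have M: "?M \<subseteq> nonconst_monomials n D" by (auto simp: monomials_in_def)
  have T: "?T \<subseteq> {..<n}" "card ?T = t" using assms by auto
  have "B \<notin> {B. B \<inter> ?M = {}}"
    if B: "B \<in> set_pmf ?R" and dim: "krull_dim (mpoly_ring n Quot (Idl\<^bsub>mpoly_ring n\<^esub> B)) \<le> ereal (real t - 1)" for B
  proof
    assume disj: "B \<in> {B. B \<inter> ?M = {}}"
    have "B \<subseteq> nonconst_monomials n D" using set_random_monomials B by blast
    then have "ereal (real t) \<le> krull_dim (mpoly_ring n Quot (Idl\<^bsub>mpoly_ring n\<^esub> B))"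
      using disj assms(2) by (intro krull_dim_ge_if_no_generator) (auto simp: monomials_in_def)
    with dim have "ereal (real t) \<le> ereal (real t - 1)" by (rule order_trans[rotated])
    then show False by simp
  qed
  then have "measure_pmf.prob (random_monomial_ideal n D p) ?G \<le> measure_pmf.prob ?R (- {B. B \<inter> ?M = {}})"
    unfolding random_monomial_ideal_def measure_map_pmf
    by (intro measure_pmf.finite_measure_mono_AE) (auto simp: AE_measure_pmf_iff)
  also have "\<dots> = 1 - (1 - p) ^ card ?M"
    using measure_pmf.prob_compl[of "{B. B \<inter> ?M = {}}" ?R] prob_random_monomials_disjoint[OF M p]
    by (simp add: Compl_eq_Diff_UNIV)
  also have "\<dots> \<le> card ?M * p"
    using Bernoulli_inequality[of "- p" "card ?M"] p by simp
  also have "\<dots> \<le> (real D + 1) ^ t * p"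
  proof -
    have "card ?M \<le> (D + 1) ^ t" using card_monomials_in_le[OF T(1), of D] T(2) by simp
    then have "real (card ?M) \<le> real ((D + 1) ^ t)" by (simp only: of_nat_le_iff)
    then show ?thesis using p by (intro mult_right_mono) (simp_all add: add.commute)
  qed
  finally show ?thesis .
qed

text \<open>If the dimension is \<open>t\<close> or more, some set of \<open>t\<close> variables supports no generator. The union
  bound over these sets is combined with \<open>1 - p \<le> exp (- p)\<close>.\<close>

lemma prob_dim_gt:
  assumes t: "1 \<le> t" "t * q \<le> D" and p: "0 \<le> p" "p \<le> 1"
  shows "measure_pmf.prob (random_monomial_ideal n D p :: ('k::field) polys set pmf)
      {\<II>. krull_dim (mpoly_ring n Quot \<II>) \<le> ereal (real t - 1)} \<ge> 1 - real (n choose t) * exp (- (p * real q ^ t))"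
proof -
  let ?G = "{\<II> :: 'k polys set. krull_dim (mpoly_ring n Quot \<II>) \<le> ereal (real t - 1)}"
  let ?R = "random_monomials n D p :: 'k polys set pmf"
  let ?M = "\<lambda>T. monomials_in n D T :: 'k polys set"
  let ?F = "{T. T \<subseteq> {..<n} \<and> card T = t}"
  have F: "finite ?F" "card ?F = n choose t" using n_subsets[of "{..<n}" t] by auto
  have "B \<in> (\<Union>T\<in>?F. {B. B \<inter> ?M T = {}})"
    if B: "B \<in> set_pmf ?R" and dim: "\<not> krull_dim (mpoly_ring n Quot (Idl\<^bsub>mpoly_ring n\<^esub> B)) \<le> ereal (real t - 1)" for B
  proof (rule ccontr)
    assume no: "B \<notin> (\<Union>T\<in>?F. {B. B \<inter> ?M T = {}})"
    have sub: "B \<subseteq> nonconst_monomials n D" using set_random_monomials B by blast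
    have "krull_dim (mpoly_ring n Quot (Idl\<^bsub>mpoly_ring n\<^esub> B)) \<le> ereal (real t - 1)"
      by (rule krull_dim_le_if_generators[OF t(1) sub]) (use no in \<open>fastforce simp: monomials_in_def\<close>)
    with dim show False by contradiction
  qed
  then have "measure_pmf.prob (random_monomial_ideal n D p) (- ?G) \<le>
      measure_pmf.prob ?R (\<Union>T\<in>?F. {B. B \<inter> ?M T = {}})"
    unfolding random_monomial_ideal_def measure_map_pmf
    by (intro measure_pmf.finite_measure_mono_AE) (auto simp: AE_measure_pmf_iff)
  also have "\<dots> \<le> (\<Sum>T\<in>?F. measure_pmf.prob ?R {B. B \<inter> ?M T = {}})"
    using F by (intro measure_pmf.finite_measure_subadditive_finite) auto
  also have "\<dots> \<le> (\<Sum>T\<in>?F. exp (- (p * real q ^ t)))"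
  proof (rule sum_mono)
    fix T assume T: "T \<in> ?F"
    then have "T \<noteq> {}" using t by auto
    have "measure_pmf.prob ?R {B. B \<inter> ?M T = {}} = (1 - p) ^ card (?M T)"
      using p by (intro prob_random_monomials_disjoint) (auto simp: monomials_in_def)
    also have "\<dots> \<le> exp (- p) ^ card (?M T)"
      using p exp_ge_add_one_self[of "- p"] by (intro power_mono) auto
    also have "\<dots> \<le> exp (- p) ^ (q ^ t)"
      using T t p \<open>T \<noteq> {}\<close> card_monomials_in_ge[of T n q D] by (intro power_decreasing) auto
    also have "\<dots> = exp (- (p * real q ^ t))"
      by (simp add: mult.commute flip: exp_of_nat_mult)
    finally show "measure_pmf.prob ?R {B. B \<inter> ?M T = {}} \<le> exp (- (p * real q ^ t))" .
  qed
  also have "\<dots> = real (n choose t) * exp (- (p * real q ^ t))" using F by simp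
  finally show ?thesis
    using measure_pmf.prob_compl[of ?G "random_monomial_ideal n D p"]
    by (simp add: Compl_eq_Diff_UNIV)
qed

theorem theorem3p4:
  fixes n t :: nat and p :: "nat \<Rightarrow> real"
  assumes "1 \<le> t" and "t \<le> n"
    and "\<And>D. 0 \<le> p D \<and> p D \<le> 1"
  shows "(p \<in> o(\<lambda>D. 1 / real D ^ t) \<longrightarrow>
            (\<lambda>D. measure_pmf.prob (random_monomial_ideal n D (p D) :: ('k::field) polys set pmf)
               {\<II>. krull_dim (mpoly_ring n Quot \<II>) \<le> ereal (real t - 1)}) \<longlonglongrightarrow> 0)
       \<and> (p \<in> \<omega>(\<lambda>D. 1 / real D ^ t) \<longrightarrow>
            (\<lambda>D. measure_pmf.prob (random_monomial_ideal n D (p D) :: ('k::field) polys set pmf)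
               {\<II>. krull_dim (mpoly_ring n Quot \<II>) \<le> ereal (real t - 1)}) \<longlonglongrightarrow> 1)"
    (is "(_ \<longrightarrow> ?P \<longlonglongrightarrow> 0) \<and> (_ \<longrightarrow> ?P \<longlonglongrightarrow> 1)")
proof (intro conjI impI)
  have p: "0 \<le> p D" "p D \<le> 1" for D using assms(3) by auto
  show "?P \<longlonglongrightarrow> 0" if small: "p \<in> o(\<lambda>D. 1 / real D ^ t)"
  proof (rule tendsto_sandwich[of "\<lambda>_. 0"])
    have "(\<lambda>D. p D / (1 / real D ^ t)) \<longlonglongrightarrow> 0"
      using small by (rule smalloD_tendsto)
    then show "(\<lambda>D. 2 ^ t * (p D / (1 / real D ^ t))) \<longlonglongrightarrow> 0"
      by (rule tendsto_mult_right_zero)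
    show "\<forall>\<^sub>F D in sequentially. ?P D \<le> 2 ^ t * (p D / (1 / real D ^ t))"
      using eventually_ge_at_top[of 1]
    proof eventually_elim
      case (elim D)
      have "?P D \<le> (real D + 1) ^ t * p D"
        by (rule prob_dim_le[OF assms(1,2) p])
      also have "\<dots> \<le> (2 * real D) ^ t * p D"
        using elim p by (intro mult_right_mono power_mono) auto
      finally show ?case by (simp add: power_mult_distrib mult_ac)
    qed
  qed auto
  show "?P \<longlonglongrightarrow> 1" if large: "p \<in> \<omega>(\<lambda>D. 1 / real D ^ t)"
  proof (rule tendsto_sandwich[where h = "\<lambda>_. 1"])
    let ?e = "\<lambda>D. p D * real D ^ t / (2 * real t) ^ t"
    have nz: "\<forall>\<^sub>F D in sequentially. 1 / real D ^ t \<noteq> 0"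
      using eventually_gt_at_top[of 0] by eventually_elim auto
    have "filterlim (\<lambda>D. p D / (1 / real D ^ t)) at_top sequentially"
    proof -
      have "filterlim (\<lambda>D. p D / (1 / real D ^ t)) at_infinity sequentially"
        using large nz by (rule smallomegaD_filterlim_at_infinity)
      then show ?thesis
        using p by (auto simp: filterlim_at_infinity_conv_norm_at_top abs_mult)
    qed
    then have "filterlim (\<lambda>D. p D * real D ^ t * (1 / (2 * real t) ^ t)) at_top sequentially"
      using assms(1) by (intro filterlim_at_top_mult_tendsto_pos[OF tendsto_const]) auto
    then have "filterlim ?e at_top sequentially" by simp
    then have "(\<lambda>D. exp (- ?e D)) \<longlonglongrightarrow> 0"
      by (intro filterlim_compose[OF exp_at_bot]) (simp add: filterlim_uminus_at_bot)
    then have "(\<lambda>D. 1 - real (n choose t) * exp (- ?e D)) \<longlonglongrightarrow> 1 - real (n choose t) * 0"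
      by (intro tendsto_intros)
    then show "(\<lambda>D. 1 - real (n choose t) * exp (- ?e D)) \<longlonglongrightarrow> 1" by simp
    show "\<forall>\<^sub>F D in sequentially. 1 - real (n choose t) * exp (- ?e D) \<le> ?P D"
      using eventually_ge_at_top[of t]
    proof eventually_elim
      case (elim D)
      \<comment> \<open>\<open>D \<ge> t\<close> makes the quotient positive, so that rounding down at most halves \<open>D / t\<close>.\<close>
      let ?q = "D div t"
      have "1 * t \<le> ?q * t" using elim assms(1) by (simp add: Suc_le_eq div_greater_zero_iff)
      moreover have "D < ?q * t + t"
        using assms(1) mod_less_divisor[of t D] div_mult_mod_eq[of D t] by linarith
      ultimately have "D \<le> ?q * (2 * t)" by linarith
      then have "real D \<le> real (?q * (2 * t))" by (simp only: of_nat_le_iff)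
      then have "real D / (2 * real t) \<le> real ?q"
        using assms(1) by (simp add: field_simps)
      then have "(real D / (2 * real t)) ^ t \<le> real ?q ^ t"
        by (intro power_mono) auto
      then have "?e D \<le> p D * real ?q ^ t"
        using p mult_left_mono by (fastforce simp: power_divide)
      then have "1 - real (n choose t) * exp (- ?e D) \<le> 1 - real (n choose t) * exp (- (p D * real ?q ^ t))"
        by (simp add: mult_left_mono)
      also have "\<dots> \<le> ?P D"
        using assms(1) p by (intro prob_dim_gt) auto
      finally show ?case .
    qed
  qed auto
qed

end
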